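(* Let $n\in\mathbb N$ (finite, $n\ge 1$), let $V_1\in\mathscr V_n(\mathcal H_1)$ and $V_2\in\mathscr V_n(\mathcal H_2)$, and let $\mathscr H_{V_1}$, $\mathscr H_{V_2}$ be abstract model spaces for $V_1$, $V_2$ (with respect to arbitrary models). Then $V_1$ is unitarily equivalent to $V_2$ if and only if there is an isometric multiplier from $\mathscr H_{V_1}$ onto $\mathscr H_{V_2}$, i.e. an analytic function $\Phi:\mathbb C\setminus\mathbb T\to M_n(\mathbb C)$ such that $\Phi\mathscr H_{V_1}=\mathscr H_{V_2}$ and the operator $f\mapsto\Phi f$ from $\mathscr H_{V_1}$ to $\mathscr H_{V_2}$ is isometric.
   Context: All Hilbert spaces are complex and separable. $\mathbb T$ is the unit circle. A bounded operator $V$ on $\mathcal H$ is a partial isometry if it is isometric on $\ker(V)^\perp$. It is completely non-unitary if there is no nonzero subspace $\mathcal M$ reducing $V$ such that $V|_{\mathcal M}$ is unitary on $\mathcal M$. $\mathscr V_n(\mathcal H)$ is the set of completely non-unitary partial isometries $V$ on $\mathcal H$ with $\dim\ker(V)=\dim\operatorname{Ran}(V)^\perp=n$. For $V\in\mathscr V_n(\mathcal H)$ and $\lambda\in\mathbb C\setminus\mathbb T$ put $\widetilde{\operatorname{Ran}}(V-\lambda I):=(V-\lambda I)\ker(V)^\perp$; its orthogonal complement has dimension $n$. A model for $V$ is an anti-analytic map $\Gamma:\mathbb C\setminus\mathbb T\to\mathcal B(\mathbb C^n,\mathcal H)$ such that, for each $\lambda$, $\Gamma(\lambda)$ is a linear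 bijection from $\mathbb C^n$ onto $\widetilde{\operatorname{Ran}}(V-\lambda I)^\perp$. (Models exist: if $U$ is a unitary extension of $V|_{\ker(V)^\perp}$ to $\mathcal H$ and $j:\mathbb C^n\to\operatorname{Ran}(V)^\perp$ is a linear isomorphism, then $\Gamma(\lambda)=(I-\overline\lambda U)^{-1}j$ is one; and since $V$ is completely non-unitary, the ranges of $\Gamma(\lambda)$, $\lambda\in\mathbb C\setminus\mathbb T$, span a dense subspace of $\mathcal H$.) For $f\in\mathcal H$ let $\widehat f(\lambda)=\Gamma(\lambda)^*f$. The abstract model space of $V$ for $\Gamma$ is $\mathscr H_V=\mathscr H_{V,\Gamma}=\{\widehat f: f\in\mathcal H\}$ with $\langle\widehat f,\widehat g\rangle:=\langle f,g\rangle$, a Hilbert space of $\mathbb C^n$-valued analytic functions on $\mathbb C\setminus\mathbb T$. *)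

theory Defs
  imports "HOL-Analysis.Analysis"
begin

class complex_vector = real_vector +
  fixes scaleC :: "complex \<Rightarrow> 'a \<Rightarrow> 'a"
  assumes scaleC_add_right: "scaleC c (x + y) = scaleC c x + scaleC c y"
    and scaleC_add_left: "scaleC (c + d) x = scaleC c x + scaleC d x"
    and scaleC_scaleC: "scaleC c (scaleC d x) = scaleC (c * d) x"
    and scaleC_one: "scaleC 1 x = x"
    and scaleR_scaleC: "scaleR r x = scaleC (complex_of_real r) x"

global_interpretation complex_vector:
  vector_space "scaleC :: complex \<Rightarrow> 'a \<Rightarrow> 'a::complex_vector"
  by unfold_locales
    (simp_all add: scaleC_add_right scaleC_add_left scaleC_scaleC scaleC_one)

text \<open>The inner product is linear in the first argument.\<close>

class complex_inner = complex_vector + real_normed_vector +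
  fixes cinner :: "'a \<Rightarrow> 'a \<Rightarrow> complex"
  assumes cinner_commute: "cinner x y = cnj (cinner y x)"
    and cinner_add_left: "cinner (x + y) z = cinner x z + cinner y z"
    and cinner_scaleC_left: "cinner (scaleC c x) y = c * cinner x y"
    and cinner_nonneg: "0 \<le> Re (cinner x x)"
    and cinner_eq_zero_iff: "cinner x x = 0 \<longleftrightarrow> x = 0"
    and norm_eq_sqrt_cinner: "norm x = sqrt (Re (cinner x x))"

text \<open>Separability enters through \<^class>\<open>polish_space\<close>: a metric space is separable
  iff it is second countable.\<close>

class separable_chilbert_space = complex_inner + polish_space

instantiation complex :: separable_chilbert_space
begin

definition scaleC_complex :: "complex \<Rightarrow> complex \<Rightarrow> complex"
  where "scaleC_complex c x = c * x"

definition cinner_complex :: "complex \<Rightarrow> complex \<Rightarrow> complex"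
  where "cinner_complex x y = x * cnj y"

instance
  by standard
    (simp_all add: scaleC_complex_def cinner_complex_def algebra_simps scaleR_conv_of_real
      cmod_def power2_eq_square)

end

instantiation vec :: (complex_inner, finite) complex_inner
begin

definition scaleC_vec :: "complex \<Rightarrow> 'a ^ 'b \<Rightarrow> 'a ^ 'b"
  where "scaleC_vec c x = (\<chi> i. scaleC c (x $ i))"

definition cinner_vec :: "'a ^ 'b \<Rightarrow> 'a ^ 'b \<Rightarrow> complex"
  where "cinner_vec x y = (\<Sum>i\<in>UNIV. cinner (x $ i) (y $ i))"

instance
proof
  fix x y z :: "'a ^ 'b" and c d :: complex and r :: real
  show "scaleC c (x + y) = scaleC c x + scaleC c y"
    by (simp add: scaleC_vec_def vec_eq_iff scaleC_add_right)
  show "scaleC (c + d) x = scaleC c x + scaleC d x"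
    by (simp add: scaleC_vec_def vec_eq_iff scaleC_add_left)
  show "scaleC c (scaleC d x) = scaleC (c * d) x"
    by (simp add: scaleC_vec_def vec_eq_iff scaleC_scaleC)
  show "scaleC 1 x = x"
    by (simp add: scaleC_vec_def vec_eq_iff scaleC_one)
  show "scaleR r x = scaleC (complex_of_real r) x"
    by (simp add: scaleC_vec_def vec_eq_iff scaleR_scaleC)
  show "cinner x y = cnj (cinner y x)"
    by (simp add: cinner_vec_def cinner_commute [symmetric])
  show "cinner (x + y) z = cinner x z + cinner y z"
    by (simp add: cinner_vec_def cinner_add_left sum.distrib)
  show "cinner (scaleC c x) y = c * cinner x y"
    by (simp add: cinner_vec_def scaleC_vec_def cinner_scaleC_left sum_distrib_left)
  show "0 \<le> Re (cinner x x)"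
    by (simp add: cinner_vec_def cinner_nonneg sum_nonneg)
  have self: "cinner u u = complex_of_real ((norm u)\<^sup>2)" for u :: 'a
  proof -
    have "Im (cinner u u) = 0"
      using arg_cong [OF cinner_commute [of u u], of Im] by simp
    then show ?thesis
      by (simp add: complex_eq_iff norm_eq_sqrt_cinner cinner_nonneg)
  qed
  have sum_self: "cinner x x = complex_of_real (\<Sum>i\<in>UNIV. (norm (x $ i))\<^sup>2)"
    by (simp add: cinner_vec_def self)
  show "cinner x x = 0 \<longleftrightarrow> x = 0"
    unfolding sum_self of_real_eq_0_iff by (subst sum_nonneg_eq_0_iff) (simp_all add: vec_eq_iff)
  show "norm x = sqrt (Re (cinner x x))"
    unfolding sum_self Re_complex_of_real by (simp add: norm_vec_def L2_set_def)
qed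

end

definition orth_complement :: "'a::complex_inner set \<Rightarrow> 'a set"
  where "orth_complement S = {x. \<forall>y\<in>S. cinner x y = 0}"

definition bounded_clinear :: "('a::complex_inner \<Rightarrow> 'b::complex_inner) \<Rightarrow> bool"
  where "bounded_clinear A \<longleftrightarrow>
    bounded_linear A \<and> (\<forall>c x. A (scaleC c x) = scaleC c (A x))"

definition ker :: "('a::complex_inner \<Rightarrow> 'b::complex_inner) \<Rightarrow> 'a set"
  where "ker A = {x. A x = 0}"

definition cadjoint :: "('a::complex_inner \<Rightarrow> 'b::complex_inner) \<Rightarrow> 'b \<Rightarrow> 'a"
  where "cadjoint A = (SOME B. \<forall>x y. cinner (A x) y = cinner x (B y))"

lemma cadjoint_works:
  fixes A :: "complex ^ 'n \<Rightarrow> 'b::complex_inner"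
  assumes "bounded_clinear A"
  shows "cinner (A x) y = cinner x (cadjoint A y)"
proof -
  interpret A: bounded_linear A
    using assms by (simp add: bounded_clinear_def)
  have zero: "cinner 0 z = 0" for z :: 'b
    using cinner_add_left [of 0 0 z] by simp
  have sum_left: "cinner (sum g S) z = (\<Sum>i\<in>S. cinner (g i) z)"
    if "finite S" for g :: "'n \<Rightarrow> 'b" and S z
    using that by (induction S rule: finite_induct) (simp_all add: zero cinner_add_left)
  define B where "B = (\<lambda>y. (\<chi> i. cinner y (A (axis i 1))) :: complex ^ 'n)"
  have "cinner (A x) y = cinner x (B y)" for x y
  proof -
    have "x = (\<Sum>i\<in>UNIV. scaleC (x $ i) (axis i 1))"
      by (simp add: vec_eq_iff scaleC_vec_def scaleC_complex_def axis_def if_distrib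
          if_distribR cong: if_cong)
    then have "A x = A (\<Sum>i\<in>UNIV. scaleC (x $ i) (axis i 1))"
      by simp
    also have "\<dots> = (\<Sum>i\<in>UNIV. scaleC (x $ i) (A (axis i 1)))"
      using assms by (simp add: A.sum bounded_clinear_def)
    finally show ?thesis
      by (simp add: sum_left cinner_scaleC_left cinner_vec_def cinner_complex_def B_def
          cinner_commute [symmetric])
  qed
  then have "\<exists>B. \<forall>x y. cinner (A x) y = cinner x (B y)"
    by blast
  then show ?thesis
    unfolding cadjoint_def by (rule someI2_ex) blast
qed

definition unitary_operator :: "('a::complex_inner \<Rightarrow> 'b::complex_inner) \<Rightarrow> bool"
  where "unitary_operator U \<longleftrightarrow>
    bounded_clinear U \<and> surj U \<and> (\<forall>x y. cinner (U x) (U y) = cinner x y)"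

definition unitarily_equivalent ::
    "('a::complex_inner \<Rightarrow> 'a) \<Rightarrow> ('b::complex_inner \<Rightarrow> 'b) \<Rightarrow> bool"
  where "unitarily_equivalent A B \<longleftrightarrow>
    (\<exists>U. unitary_operator U \<and> (\<forall>x. U (A x) = B (U x)))"

text \<open>Differentiability is with respect to the operator norm; it amounts to analyticity only
  because \<open>S\<close> is open in all uses.\<close>

definition operator_analytic_on ::
    "(complex \<Rightarrow> 'a::complex_inner \<Rightarrow> 'b::complex_inner) \<Rightarrow> complex set \<Rightarrow> bool"
  where "operator_analytic_on F S \<longleftrightarrow>
    (\<forall>z\<in>S. \<exists>D. bounded_clinear D \<and>
      ((\<lambda>w. onorm (\<lambda>x. scaleC (inverse (w - z)) (F w x - F z x) - D x)) \<longlongrightarrow> 0) (at z))"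

definition operator_antianalytic_on ::
    "(complex \<Rightarrow> 'a::complex_inner \<Rightarrow> 'b::complex_inner) \<Rightarrow> complex set \<Rightarrow> bool"
  where "operator_antianalytic_on F S \<longleftrightarrow> operator_analytic_on (\<lambda>z. F (cnj z)) (cnj ` S)"

definition partial_isometry :: "('a::complex_inner \<Rightarrow> 'a) \<Rightarrow> bool"
  where "partial_isometry V \<longleftrightarrow>
    bounded_clinear V \<and> (\<forall>x\<in>orth_complement (ker V). norm (V x) = norm x)"

definition closed_csubspace :: "'a::complex_inner set \<Rightarrow> bool"
  where "closed_csubspace M \<longleftrightarrow> complex_vector.subspace M \<and> closed M"

definition reduces :: "'a::complex_inner set \<Rightarrow> ('a \<Rightarrow> 'a) \<Rightarrow> bool"
  where "reduces M V \<longleftrightarrow> closed_csubspace M \<and> V ` M \<subseteq> M \<and>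
    V ` orth_complement M \<subseteq> orth_complement M"

definition unitary_on :: "'a::complex_inner set \<Rightarrow> ('a \<Rightarrow> 'a) \<Rightarrow> bool"
  where "unitary_on M V \<longleftrightarrow>
    V ` M = M \<and> (\<forall>x\<in>M. \<forall>y\<in>M. cinner (V x) (V y) = cinner x y)"

definition completely_non_unitary :: "('a::complex_inner \<Rightarrow> 'a) \<Rightarrow> bool"
  where "completely_non_unitary V \<longleftrightarrow> \<not> (\<exists>M. M \<noteq> {0} \<and> reduces M V \<and> unitary_on M V)"

text \<open>The algebraic dimension \<^const>\<open>complex_vector.dim\<close> is \<open>0\<close> for infinite-dimensional
  subspaces, so the definition expresses finite defect indices only for \<open>n \<ge> 1\<close>.\<close>

definition cnu_partial_isometries :: "nat \<Rightarrow> ('a::separable_chilbert_space \<Rightarrow> 'a) set"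
  where "cnu_partial_isometries n = {V. partial_isometry V \<and> completely_non_unitary V \<and>
    complex_vector.dim (ker V) = n \<and> complex_vector.dim (orth_complement (range V)) = n}"

abbreviation off_circle :: "complex set"
  where "off_circle \<equiv> - sphere 0 1"

definition Ran_tilde :: "('a::complex_inner \<Rightarrow> 'a) \<Rightarrow> complex \<Rightarrow> 'a set"
  where "Ran_tilde V l = (\<lambda>x. V x - scaleC l x) ` orth_complement (ker V)"

definition is_model ::
    "('a::complex_inner \<Rightarrow> 'a) \<Rightarrow> (complex \<Rightarrow> complex ^ 'n \<Rightarrow> 'a) \<Rightarrow> bool"
  where "is_model V \<Gamma> \<longleftrightarrow>
    operator_antianalytic_on \<Gamma> off_circle \<and>
    (\<forall>l\<in>off_circle. bounded_clinear (\<Gamma> l) \<and>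
      bij_betw (\<Gamma> l) UNIV (orth_complement (Ran_tilde V l)))"

text \<open>Functions on \<open>off_circle\<close> are represented as extensional functions, so that equality
  of sets of functions ignores values on the unit circle.\<close>

definition model_transform ::
    "(complex \<Rightarrow> complex ^ 'n \<Rightarrow> 'a::complex_inner) \<Rightarrow> 'a \<Rightarrow> complex \<Rightarrow> complex ^ 'n"
  where "model_transform \<Gamma> f = (\<lambda>l\<in>off_circle. cadjoint (\<Gamma> l) f)"

definition model_space ::
    "(complex \<Rightarrow> complex ^ 'n \<Rightarrow> 'a::complex_inner) \<Rightarrow> (complex \<Rightarrow> complex ^ 'n) set"
  where "model_space \<Gamma> = range (model_transform \<Gamma>)"

text \<open>The inner product carried over from the Hilbert space; for a model of a completely
  non-unitary partial isometry the transform is injective, so the preimages are unique.\<close>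

definition model_cinner ::
    "(complex \<Rightarrow> complex ^ 'n \<Rightarrow> 'a::complex_inner) \<Rightarrow>
      (complex \<Rightarrow> complex ^ 'n) \<Rightarrow> (complex \<Rightarrow> complex ^ 'n) \<Rightarrow> complex"
  where "model_cinner \<Gamma> F G =
    cinner (inv (model_transform \<Gamma>) F) (inv (model_transform \<Gamma>) G)"

lemma model_cinner_transform:
  "inj (model_transform \<Gamma>) \<Longrightarrow>
    model_cinner \<Gamma> (model_transform \<Gamma> f) (model_transform \<Gamma> g) = cinner f g"
  by (simp add: model_cinner_def)

definition model_norm ::
    "(complex \<Rightarrow> complex ^ 'n \<Rightarrow> 'a::complex_inner) \<Rightarrow> (complex \<Rightarrow> complex ^ 'n) \<Rightarrow> real"
  where "model_norm \<Gamma> F = sqrt (Re (model_cinner \<Gamma> F F))"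

definition mult_op ::
    "(complex \<Rightarrow> complex ^ 'n ^ 'n) \<Rightarrow> (complex \<Rightarrow> complex ^ 'n) \<Rightarrow> complex \<Rightarrow> complex ^ 'n"
  where "mult_op \<Phi> F = (\<lambda>l\<in>off_circle. \<Phi> l *v F l)"

definition isometric_multiplier ::
    "(complex \<Rightarrow> complex ^ 'n ^ 'n) \<Rightarrow> (complex \<Rightarrow> complex ^ 'n \<Rightarrow> 'a::complex_inner) \<Rightarrow>
      (complex \<Rightarrow> complex ^ 'n \<Rightarrow> 'b::complex_inner) \<Rightarrow> bool"
  where "isometric_multiplier \<Phi> \<Gamma>1 \<Gamma>2 \<longleftrightarrow>
    (\<forall>i j. (\<lambda>l. \<Phi> l $ i $ j) analytic_on off_circle) \<and>
    mult_op \<Phi> ` model_space \<Gamma>1 = model_space \<Gamma>2 \<and>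
    (\<forall>F\<in>model_space \<Gamma>1. model_norm \<Gamma>2 (mult_op \<Phi> F) = model_norm \<Gamma>1 F)"

end

theory Submission
  imports Defs
begin

text \<open>A vector \<open>f\<close> has \<open>\<Gamma>(\<lambda>)\<^sup>* f = 0\<close> iff \<open>f\<close> lies in the closed subspace \<open>(V - \<lambda>) ker(V)\<^sup>\<bottom>\<close>.
  Hence a multiplier corresponds to a unitary \<open>U\<close> carrying these subspaces for \<open>V\<^sub>1\<close> onto those
  for \<open>V\<^sub>2\<close>, for every \<open>\<lambda>\<close> off the circle. Such a family determines \<open>V\<close>:
  \<open>g - \<lambda> h\<close> lies in it for all \<open>\<lambda>\<close> only if \<open>h \<in> ker(V)\<^sup>\<bottom>\<close> (let \<open>\<lambda> \<rightarrow> \<infinity>\<close>) and \<open>g = V h\<close>. The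
  latter holds because the intersection of the family reduces \<open>V\<close> to a unitary, so it is zero.\<close>

section \<open>Complex Hilbert spaces\<close>

lemma cinner_zero_left [simp]: "cinner 0 x = 0"
  using cinner_add_left [of 0 0 x] by simp

lemma cinner_zero_right [simp]: "cinner x 0 = 0"
  by (subst cinner_commute) simp

lemma cinner_add_right: "cinner x (y + z) = cinner x y + cinner x z"
  by (metis cinner_add_left cinner_commute complex_cnj_add)

lemma cinner_scaleC_right: "cinner x (scaleC c y) = cnj c * cinner x y"
  by (metis cinner_scaleC_left cinner_commute complex_cnj_mult)

lemma cinner_diff_left: "cinner (x - y) z = cinner x z - cinner y z"
  by (metis add_diff_cancel_right' cinner_add_left diff_add_cancel)

lemma cinner_diff_right: "cinner x (y - z) = cinner x y - cinner x z"
  by (metis add_diff_cancel_right' cinner_add_right diff_add_cancel)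

lemma cinner_self: "cinner x x = complex_of_real ((norm x)\<^sup>2)"
proof -
  have "Im (cinner x x) = 0"
    using arg_cong [OF cinner_commute [of x x], of Im] by simp
  then show ?thesis
    by (simp add: complex_eq_iff norm_eq_sqrt_cinner cinner_nonneg)
qed

lemma cinner_ext:
  assumes "\<And>y. cinner x y = cinner x' y"
  shows "x = x'"
  by (metis assms cinner_diff_left cinner_eq_zero_iff diff_self eq_iff_diff_eq_0)

lemma norm_scaleC:
  fixes x :: "'a::complex_inner"
  shows "norm (scaleC c x) = cmod c * norm x"
proof -
  have "complex_of_real ((norm (scaleC c x))\<^sup>2) = (c * cnj c) * cinner x x"
    unfolding cinner_self [symmetric] by (simp add: cinner_scaleC_left cinner_scaleC_right)
  also have "\<dots> = complex_of_real ((cmod c * norm x)\<^sup>2)"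
    unfolding complex_norm_square [symmetric] cinner_self by (simp add: power_mult_distrib)
  finally have "complex_of_real ((norm (scaleC c x))\<^sup>2) = complex_of_real ((cmod c * norm x)\<^sup>2)" .
  then show ?thesis
    unfolding of_real_eq_iff by (simp add: power2_eq_iff_nonneg)
qed

text \<open>Pythagoras for the component of \<open>x\<close> along \<open>y\<close>. It yields
  Cauchy-Schwarz and later the orthogonality of a nearest point. For \<open>y = 0\<close> both sides
  are \<open>(norm x)\<^sup>2\<close>, since division by zero gives zero.\<close>

lemma norm_diff_projection:
  "(norm (x - scaleC (cinner x y / complex_of_real ((norm y)\<^sup>2)) y))\<^sup>2
    = (norm x)\<^sup>2 - (cmod (cinner x y))\<^sup>2 / (norm y)\<^sup>2"
proof -
  let ?a = "cinner x y" and ?N = "complex_of_real ((norm y)\<^sup>2)"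
  have "complex_of_real ((norm (x - scaleC (?a / ?N) y))\<^sup>2)
      = cinner x x - cnj (?a / ?N) * ?a - (?a / ?N) * cnj ?a
        + (?a / ?N) * cnj (?a / ?N) * ?N"
    unfolding cinner_self [symmetric]
    by (simp add: cinner_diff_left cinner_diff_right cinner_scaleC_left cinner_scaleC_right
        algebra_simps cinner_commute [of y x])
  also have "\<dots> = cinner x x - ?a * cnj ?a / ?N"
    by (cases "y = 0") (simp_all add: field_simps power4_eq_xxxx power2_eq_square)
  also have "\<dots> = complex_of_real ((norm x)\<^sup>2 - (cmod ?a)\<^sup>2 / (norm y)\<^sup>2)"
    by (simp add: cinner_self flip: complex_norm_square)
  finally show ?thesis
    unfolding of_real_eq_iff .
qed

lemma cinner_Cauchy_Schwarz: "cmod (cinner x y) \<le> norm x * norm y"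
proof (cases "y = 0")
  case False
  have "(cmod (cinner x y))\<^sup>2 / (norm y)\<^sup>2 \<le> (norm x)\<^sup>2"
    using norm_diff_projection [of x y] by (metis diff_ge_0_iff_ge zero_le_power2)
  then have "(cmod (cinner x y))\<^sup>2 \<le> (norm x * norm y)\<^sup>2"
    using False by (simp add: field_simps)
  then show ?thesis
    by (rule power2_le_imp_le) simp
qed simp

lemma bounded_linear_cinner_left: "bounded_linear (\<lambda>x. cinner x y)"
proof (rule bounded_linear_intro)
  show "norm (cinner x y) \<le> norm x * norm y" for x
    by (rule cinner_Cauchy_Schwarz)
qed (simp_all add: cinner_add_left scaleR_scaleC cinner_scaleC_left scaleC_complex_def)

lemma subspace_orth_complement: "complex_vector.subspace (orth_complement S)"
  by (auto simp: complex_vector.subspace_def orth_complement_def cinner_add_left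
      cinner_scaleC_left)

lemma closed_orth_complement: "closed (orth_complement S)"
proof -
  have "orth_complement S = (\<Inter>y\<in>S. {x. cinner x y = 0})"
    by (auto simp: orth_complement_def)
  moreover have "closed {x. cinner x y = 0}" for y
    by (intro closed_Collect_eq linear_continuous_on bounded_linear_cinner_left) simp
  ultimately show ?thesis
    by auto
qed

lemma orth_complementD:
  assumes "x \<in> orth_complement S" "y \<in> S"
  shows "cinner x y = 0" "cinner y x = 0"
  using assms by (auto simp: orth_complement_def cinner_commute [of y x])

lemma csubspace_imp_subspace:
  assumes "complex_vector.subspace M"
  shows "subspace M"
  using assms by (auto simp: complex_vector.subspace_def subspace_def scaleR_scaleC)

section \<open>Orthogonal projection onto closed subspaces\<close>

lemma parallelogram_law:
  fixes x y :: "'a::complex_inner"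
  shows "(norm (x + y))\<^sup>2 + (norm (x - y))\<^sup>2 = 2 * (norm x)\<^sup>2 + 2 * (norm y)\<^sup>2"
proof -
  have "complex_of_real ((norm (x + y))\<^sup>2 + (norm (x - y))\<^sup>2)
      = complex_of_real (2 * (norm x)\<^sup>2 + 2 * (norm y)\<^sup>2)"
    unfolding of_real_add of_real_mult cinner_self [symmetric]
    by (simp add: cinner_add_left cinner_add_right cinner_diff_left cinner_diff_right)
  then show ?thesis
    unfolding of_real_eq_iff .
qed

text \<open>The nearest point of \<open>M\<close> does it: the parallelogram law makes a minimizing
  sequence Cauchy, completeness gives a limit at minimal distance, and minimality forces the
  remainder to be orthogonal to \<open>M\<close>.\<close>

lemma orthogonal_projection_exists:
  fixes M :: "'a::{complex_inner,complete_space} set"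
  assumes "closed_csubspace M"
  obtains m where "m \<in> M" "x - m \<in> orth_complement M"
proof -
  have sub: "complex_vector.subspace M" and "closed M"
    using assms by (auto simp: closed_csubspace_def)
  have sub': "subspace M"
    using sub by (rule csubspace_imp_subspace)
  define d where "d = (INF m\<in>M. (norm (x - m))\<^sup>2)"
  have ne: "M \<noteq> {}"
    using subspace_0 [OF sub'] by auto
  have bdd: "bdd_below ((\<lambda>m. (norm (x - m))\<^sup>2) ` M)"
    by (rule bdd_belowI2 [where m = 0]) simp
  have d_le: "d \<le> (norm (x - m))\<^sup>2" if "m \<in> M" for m
    unfolding d_def using bdd that by (rule cINF_lower)
  have "\<exists>m\<in>M. (norm (x - m))\<^sup>2 < d + inverse (Suc k)" for k
    using cINF_less_iff [OF ne bdd, of "d + inverse (Suc k)"] by (simp add: d_def)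
  then obtain y where y: "\<And>k. y k \<in> M" "\<And>k. (norm (x - y k))\<^sup>2 < d + inverse (Suc k)"
    by metis
  have dist: "(norm (y i - y j))\<^sup>2 \<le> 2 * inverse (Suc i) + 2 * inverse (Suc j)" for i j
  proof -
    \<comment> \<open>The midpoint lies in \<open>M\<close>, so its squared distance from
      \<open>x\<close> is at least \<open>d\<close>; in the parallelogram law this leaves only the
      two excesses over \<open>d\<close> to bound \<open>y i - y j\<close>.\<close>
    let ?m = "(1/2) *\<^sub>R (y i + y j)"
    have "?m \<in> M"
      by (intro subspace_mul subspace_add sub' y)
    then have "d \<le> (norm (x - ?m))\<^sup>2"
      by (rule d_le)
    moreover have "(x - y i) + (x - y j) = 2 *\<^sub>R (x - ?m)"
      by (simp add: scaleR_2 algebra_simps)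
    then have "(norm ((x - y i) + (x - y j)))\<^sup>2 = 4 * (norm (x - ?m))\<^sup>2"
      by (simp add: power_mult_distrib)
    ultimately show ?thesis
      using parallelogram_law [of "x - y i" "x - y j"] y(2) [of i] y(2) [of j]
      by (simp add: norm_minus_commute)
  qed
  have "Cauchy y"
  proof (rule metric_CauchyI)
    fix e :: real
    assume "0 < e"
    then obtain N where N: "inverse (Suc N) < e\<^sup>2 / 4"
      using reals_Archimedean [of "e\<^sup>2 / 4"] by auto
    have "dist (y i) (y j) < e" if "N \<le> i" "N \<le> j" for i j
    proof -
      have "inverse (real (Suc i)) \<le> inverse (Suc N)" "inverse (real (Suc j)) \<le> inverse (Suc N)"
        using that by (simp_all add: field_simps)
      with dist [of i j] N have "(norm (y i - y j))\<^sup>2 < e\<^sup>2"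
        by linarith
      then show ?thesis
        using \<open>0 < e\<close> by (simp add: dist_norm power_less_imp_less_base)
    qed
    then show "\<exists>N. \<forall>i\<ge>N. \<forall>j\<ge>N. dist (y i) (y j) < e"
      by blast
  qed
  then obtain m where m: "y \<longlonglongrightarrow> m"
    using Cauchy_convergent_iff convergent_def by blast
  have "m \<in> M"
    using \<open>closed M\<close> m y(1) by (metis closed_sequentially)
  have "(norm (x - m))\<^sup>2 \<le> d"
  proof (rule LIMSEQ_le)
    show "(\<lambda>k. (norm (x - y k))\<^sup>2) \<longlonglongrightarrow> (norm (x - m))\<^sup>2"
      by (intro tendsto_intros m)
    show "(\<lambda>k. d + inverse (real (Suc k))) \<longlonglongrightarrow> d"
      using tendsto_add [OF tendsto_const LIMSEQ_inverse_real_of_nat, of d] by simp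
    show "\<exists>N. \<forall>k\<ge>N. (norm (x - y k))\<^sup>2 \<le> d + inverse (real (Suc k))"
      using y(2) less_imp_le by blast
  qed
  have "cinner (x - m) u = 0" if "u \<in> M" for u
  proof (cases "u = 0")
    case False
    \<comment> \<open>Moving \<open>m\<close> by this multiple of \<open>u\<close> lowers the
      squared distance by exactly
      \<open>(cmod (cinner (x - m) u))\<^sup>2 / (norm u)\<^sup>2\<close>, so minimality makes the
      inner product vanish.\<close>
    let ?c = "cinner (x - m) u / complex_of_real ((norm u)\<^sup>2)"
    have "m + scaleC ?c u \<in> M"
      using sub \<open>m \<in> M\<close> that by (intro complex_vector.subspace_add complex_vector.subspace_scale)
    then have "(norm (x - m))\<^sup>2 \<le> (norm (x - m - scaleC ?c u))\<^sup>2"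
      using \<open>(norm (x - m))\<^sup>2 \<le> d\<close> d_le by (metis diff_diff_eq order_trans)
    then show ?thesis
      unfolding norm_diff_projection using False by (simp add: divide_le_0_iff)
  qed simp
  then show thesis
    using \<open>m \<in> M\<close> by (intro that) (auto simp: orth_complement_def)
qed

lemma orth_complement_orth_complement:
  fixes M :: "'a::{complex_inner,complete_space} set"
  assumes "closed_csubspace M"
  shows "orth_complement (orth_complement M) = M"
proof
  show "M \<subseteq> orth_complement (orth_complement M)"
    by (auto simp: orth_complement_def [of "orth_complement M"] orth_complementD)
  show "orth_complement (orth_complement M) \<subseteq> M"
  proof
    fix x
    assume x: "x \<in> orth_complement (orth_complement M)"
    obtain m where m: "m \<in> M" "x - m \<in> orth_complement M"
      using assms by (rule orthogonal_projection_exists)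
    have "cinner (x - m) (x - m) = 0"
      using orth_complementD(2) [OF x m(2)] orth_complementD(1) [OF m(2,1)]
      by (simp add: cinner_diff_right)
    with m show "x \<in> M"
      by (simp add: cinner_eq_zero_iff)
  qed
qed

section \<open>The ranges of \<open>V - \<lambda>\<close>\<close>

lemma bounded_clinear_bounded_linear: "bounded_clinear A \<Longrightarrow> bounded_linear A"
  and bounded_clinear_scaleC: "bounded_clinear A \<Longrightarrow> A (scaleC c x) = scaleC c (A x)"
  by (auto simp: bounded_clinear_def)

lemma bounded_clinear_add: "bounded_clinear A \<Longrightarrow> A (x + y) = A x + A y"
  and bounded_clinear_diff: "bounded_clinear A \<Longrightarrow> A (x - y) = A x - A y"
  and bounded_clinear_zero: "bounded_clinear A \<Longrightarrow> A 0 = 0"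
  by (auto dest!: bounded_clinear_bounded_linear
      simp: linear_add linear_diff linear_0 bounded_linear.linear)

lemma bounded_linear_scaleC:
  "bounded_linear (scaleC c :: 'a \<Rightarrow> 'a::complex_inner)"
  by (rule bounded_linear_intro [where K = "cmod c"])
    (simp_all add: scaleC_add_right scaleR_scaleC scaleC_scaleC norm_scaleC mult.commute)

lemma closed_csubspace_ker:
  assumes "bounded_clinear A"
  shows "closed_csubspace (ker A)"
proof -
  have "closed {x. A x = 0}"
    using assms
    by (intro closed_Collect_eq linear_continuous_on continuous_on_const
        bounded_clinear_bounded_linear)
  with assms show ?thesis
    by (auto simp: closed_csubspace_def complex_vector.subspace_def ker_def bounded_clinear_add
        bounded_clinear_zero bounded_clinear_scaleC)
qed

lemma Ran_tildeI: "m \<in> orth_complement (ker V) \<Longrightarrow> y = V m - scaleC l m \<Longrightarrow> y \<in> Ran_tilde V l"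
  by (auto simp: Ran_tilde_def)

lemma Ran_tildeE:
  assumes "f \<in> Ran_tilde V l"
  obtains m where "m \<in> orth_complement (ker V)" "f = V m - scaleC l m"
  using assms by (auto simp: Ran_tilde_def)

lemma partial_isometry_norm:
  assumes "partial_isometry V" "m \<in> orth_complement (ker V)"
  shows "norm (V m) = norm m"
  using assms by (simp add: partial_isometry_def)

lemma partial_isometry_clinear: "partial_isometry V \<Longrightarrow> bounded_clinear V"
  by (simp add: partial_isometry_def)

text \<open>The reverse triangle inequality, as \<open>V\<close> preserves norms on its initial
  space. Off the circle the factor is positive, so \<open>V - l\<close> is bounded below there; this
  gives closed ranges and norm bounds for preimages.\<close>

lemma Ran_tilde_lower_bound:
  assumes "partial_isometry V" "m \<in> orth_complement (ker V)"
  shows "\<bar>1 - cmod l\<bar> * norm m \<le> norm (V m - scaleC l m)"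
proof -
  have "\<bar>1 - cmod l\<bar> * norm m = \<bar>norm (V m) - norm (scaleC l m)\<bar>"
    by (simp add: partial_isometry_norm [OF assms] norm_scaleC abs_mult flip: left_diff_distrib)
       (metis abs_mult abs_norm_cancel left_diff_distrib mult_1)
  also have "\<dots> \<le> norm (V m - scaleC l m)"
    by (rule norm_triangle_ineq3)
  finally show ?thesis .
qed

lemma subspace_Ran_tilde:
  assumes "bounded_clinear V"
  shows "complex_vector.subspace (Ran_tilde V l)"
proof -
  note sub = subspace_orth_complement [of "ker V"]
  note lin = bounded_clinear_add [OF assms] bounded_clinear_scaleC [OF assms]
    bounded_clinear_zero [OF assms]
  show ?thesis
    unfolding complex_vector.subspace_def
  proof (intro conjI ballI allI)
    show "0 \<in> Ran_tilde V l"
      using complex_vector.subspace_0 [OF sub] by (rule Ran_tildeI) (simp add: lin)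
  next
    fix x y
    assume "x \<in> Ran_tilde V l" "y \<in> Ran_tilde V l"
    then obtain m k where mk: "m \<in> orth_complement (ker V)" "k \<in> orth_complement (ker V)"
      "x = V m - scaleC l m" "y = V k - scaleC l k"
      by (auto elim!: Ran_tildeE)
    show "x + y \<in> Ran_tilde V l"
      using complex_vector.subspace_add [OF sub mk(1,2)]
      by (rule Ran_tildeI) (simp add: mk lin scaleC_add_right)
  next
    fix c x
    assume "x \<in> Ran_tilde V l"
    then obtain m where m: "m \<in> orth_complement (ker V)" "x = V m - scaleC l m"
      by (auto elim!: Ran_tildeE)
    show "scaleC c x \<in> Ran_tilde V l"
      using complex_vector.subspace_scale [OF sub m(1), of c]
      by (rule Ran_tildeI)
        (simp add: m lin complex_vector.scale_right_diff_distrib mult.commute)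
  qed
qed

text \<open>A bounded operator that is bounded below maps a complete subspace onto a complete one,
  and the initial space is complete because it is closed.\<close>

lemma closed_Ran_tilde:
  fixes V :: "'a::{complex_inner,complete_space} \<Rightarrow> 'a"
  assumes V: "partial_isometry V" and l: "l \<in> off_circle"
  shows "closed_csubspace (Ran_tilde V l)"
proof -
  have "complete (Ran_tilde V l)"
    unfolding Ran_tilde_def
  proof (rule complete_isometric_image)
    show "0 < \<bar>1 - cmod l\<bar>"
      using l by auto
    show "subspace (orth_complement (ker V))"
      by (intro csubspace_imp_subspace subspace_orth_complement)
    show "bounded_linear (\<lambda>x. V x - scaleC l x)"
      using V by (intro bounded_linear_sub bounded_linear_scaleC bounded_clinear_bounded_linear
          partial_isometry_clinear)
    show "complete (orth_complement (ker V))"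
      by (simp add: complete_eq_closed closed_orth_complement)
  qed (use Ran_tilde_lower_bound [OF V] in blast)
  then show ?thesis
    by (simp add: closed_csubspace_def complete_imp_closed subspace_Ran_tilde
        partial_isometry_clinear V)
qed

section \<open>Recovering the partial isometry from its family of ranges\<close>

text \<open>For large real \<open>r\<close>, write \<open>g - r h = V m - r m\<close> with
  \<open>m\<close> in the initial space. Then \<open>m\<close> stays bounded and
  \<open>m - h = (V m - g) / r\<close> tends to zero, so \<open>h\<close> is a limit of initial
  vectors.\<close>

lemma mem_initial_space:
  assumes V: "partial_isometry V"
    and "\<And>l. l \<in> off_circle \<Longrightarrow> g - scaleC l h \<in> Ran_tilde V l"
  shows "h \<in> orth_complement (ker V)"
proof -
  have "\<exists>m\<in>orth_complement (ker V). dist m h < e" if "0 < e" for e :: real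
  proof -
    \<comment> \<open>\<open>C\<close> will bound \<open>norm (V m - g)\<close>. The summand
      \<open>2\<close> in \<open>r\<close> keeps \<open>r\<close> off the circle and makes
      \<open>C / r < e\<close> strict.\<close>
    define C where "C = 2 * norm g + 2 * norm h"
    define r where "r = C / e + 2"
    have "0 \<le> C"
      by (simp add: C_def)
    then have r: "2 \<le> r" "C / r < e"
      using that by (auto simp: r_def field_simps add_strict_increasing2)
    then have "complex_of_real r \<in> off_circle"
      by auto
    then obtain m where m: "m \<in> orth_complement (ker V)"
      and eq: "g - scaleC r h = V m - scaleC r m"
      using assms(2) by (meson Ran_tildeE)
    have "(r - 1) * norm m \<le> norm (g - scaleC r h)"
      using Ran_tilde_lower_bound [OF V m, of r] r eq by simp
    also have "\<dots> \<le> norm g + r * norm h"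
      using norm_triangle_ineq4 [of g "scaleC r h"] r by (simp add: norm_scaleC)
    \<comment> \<open>The two sides differ by \<open>(r - 2) * (norm g + norm h)\<close>; the common
      factor \<open>r - 1\<close> can then be cancelled, leaving a bound on \<open>m\<close>
      independent of \<open>r\<close>.\<close>
    also have "\<dots> \<le> (r - 1) * (norm g + 2 * norm h)"
    proof -
      have "0 \<le> (r - 2) * norm g + (r - 2) * norm h"
        using r by (intro add_nonneg_nonneg mult_nonneg_nonneg) auto
      then show ?thesis
        by (simp add: algebra_simps)
    qed
    finally have nm: "norm m \<le> norm g + 2 * norm h"
      using r by simp
    have "r * norm (m - h) = norm (V m - g)"
    proof -
      have "scaleC r (m - h) = V m - g"
        using eq by (simp add: complex_vector.scale_right_diff_distrib algebra_simps)
      then have "norm (scaleC r (m - h)) = norm (V m - g)"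
        by simp
      with r show ?thesis
        by (simp add: norm_scaleC)
    qed
    also have "\<dots> \<le> C"
      using norm_triangle_ineq4 [of "V m" g] nm by (simp add: partial_isometry_norm [OF V m] C_def)
    finally have "norm (m - h) \<le> C / r"
      using r by (simp add: field_simps)
    then have "dist m h < e"
      using r(2) by (simp add: dist_norm)
    with m show ?thesis
      by blast
  qed
  then have "h \<in> closure (orth_complement (ker V))"
    by (auto simp: closure_approachable)
  then show ?thesis
    by (simp add: closed_orth_complement)
qed

text \<open>This is the case in which one cannot divide by \<open>l\<close>, so it is reached as a
  limit. For small \<open>r > 0\<close>, \<open>V m = V k - r k\<close> gives
  \<open>k = V ((k - m) / r)\<close>, so \<open>k\<close> lies in the range at \<open>0\<close>,
  while \<open>norm (k - m) = r * norm k\<close> tends to zero.\<close>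

lemma mem_Ran_tilde_zero:
  fixes V :: "'a::{complex_inner,complete_space} \<Rightarrow> 'a"
  assumes V: "partial_isometry V"
    and m: "m \<in> orth_complement (ker V)"
    and f: "\<And>l. l \<in> off_circle \<Longrightarrow> V m \<in> Ran_tilde V l"
  shows "m \<in> Ran_tilde V 0"
proof -
  have "\<exists>y\<in>Ran_tilde V 0. dist y m < e" if "0 < e" for e :: real
  proof -
    \<comment> \<open>The bound \<open>1/2\<close> gives \<open>norm k \<le> 2 * norm m\<close>; the
      other one then gives \<open>norm (k - m) < e\<close>. The \<open>+ 1\<close> keeps the
      denominator positive when \<open>m = 0\<close>.\<close>
    define r where "r = min (1/2) (e / (4 * norm m + 1))"
    have r: "0 < r" "r \<le> 1/2" "2 * r * norm m < e"
    proof -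
      show "0 < r"
        using that by (auto simp: r_def intro!: divide_pos_pos add_nonneg_pos)
      show "r \<le> 1/2"
        unfolding r_def by (rule min.cobounded1)
      have D: "0 < 4 * norm m + 1"
        by (intro add_nonneg_pos) auto
      have "e * (2 * norm m) < e * (4 * norm m + 1)"
        using that norm_ge_zero [of m] by (intro mult_strict_left_mono) linarith+
      have "2 * r * norm m \<le> 2 * (e / (4 * norm m + 1)) * norm m"
        by (intro mult_right_mono mult_left_mono) (auto simp: r_def)
      also have "\<dots> < e"
        using D \<open>e * (2 * norm m) < e * (4 * norm m + 1)\<close> by (simp add: field_simps)
      finally show "2 * r * norm m < e" .
    qed
    then have "complex_of_real r \<in> off_circle"
      by auto
    then obtain k where k: "k \<in> orth_complement (ker V)" and eq: "V m = V k - scaleC r k"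
      using f by (meson Ran_tildeE)
    have "(1 - r) * norm k \<le> norm m"
      using Ran_tilde_lower_bound [OF V k, of r] r eq by (simp add: partial_isometry_norm [OF V m, symmetric])
    moreover have "1/2 * norm k \<le> (1 - r) * norm k"
      using r by (intro mult_right_mono) auto
    ultimately have nk: "norm k \<le> 2 * norm m"
      by simp
    have km: "k - m \<in> orth_complement (ker V)"
      using k m by (intro complex_vector.subspace_diff subspace_orth_complement)
    have V_km: "V (k - m) = scaleC r k"
      using eq by (simp add: bounded_clinear_diff [OF partial_isometry_clinear [OF V]])
    have "norm (k - m) = r * norm k"
      using partial_isometry_norm [OF V km] r by (simp add: V_km norm_scaleC)
    also have "\<dots> \<le> 2 * r * norm m"
      using nk r mult_left_mono [of "norm k" "2 * norm m" r] by simp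
    also note r(3)
    finally have "dist k m < e"
      by (simp add: dist_norm)
    moreover have "k \<in> Ran_tilde V 0"
    proof (rule Ran_tildeI)
      show "scaleC (inverse r) (k - m) \<in> orth_complement (ker V)"
        by (intro complex_vector.subspace_scale subspace_orth_complement km)
      show "k = V (scaleC (inverse r) (k - m)) - scaleC 0 (scaleC (inverse r) (k - m))"
        using r by (simp add: bounded_clinear_scaleC [OF partial_isometry_clinear [OF V]] V_km)
    qed
    ultimately show ?thesis
      by blast
  qed
  then have "m \<in> closure (Ran_tilde V 0)"
    by (auto simp: closure_approachable)
  moreover have "closed (Ran_tilde V 0)"
    using closed_Ran_tilde [OF V, of 0] by (simp add: closed_csubspace_def)
  ultimately show ?thesis
    by simp
qed

text \<open>Polarization: norms determine the real part of the inner product, and replacing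
  \<open>y\<close> by \<open>\<i> y\<close>, which stays in the complex subspace, determines the
  imaginary part.\<close>

lemma cinner_preserving_if_norm_preserving:
  fixes A :: "'a::complex_inner \<Rightarrow> 'b::complex_inner"
  assumes add: "\<And>x y. A (x + y) = A x + A y"
    and scale: "\<And>c x. A (scaleC c x) = scaleC c (A x)"
    and sub: "complex_vector.subspace S"
    and norm: "\<And>x. x \<in> S \<Longrightarrow> norm (A x) = norm x"
    and "x \<in> S" "y \<in> S"
  shows "cinner (A x) (A y) = cinner x y"
proof -
  have Re_eq: "Re (cinner u v) = ((norm (u + v))\<^sup>2 - (norm u)\<^sup>2 - (norm v)\<^sup>2) / 2"
    for u v :: "'c::complex_inner"
  proof -
    have "cinner (u + v) (u + v) = cinner u u + cinner v v + (cinner u v + cnj (cinner u v))"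
      by (simp add: cinner_add_left cinner_add_right cinner_commute [of v u])
    then have "Re (cinner (u + v) (u + v)) = Re (cinner u u) + Re (cinner v v) + 2 * Re (cinner u v)"
      by simp
    then show ?thesis
      by (simp add: cinner_self)
  qed
  have Im_eq: "Im (cinner u v) = Re (cinner u (scaleC \<i> v))" for u v :: "'c::complex_inner"
    by (simp add: cinner_scaleC_right)
  have Re: "Re (cinner (A u) (A v)) = Re (cinner u v)" if "u \<in> S" "v \<in> S" for u v
  proof -
    have "u + v \<in> S"
      using sub that by (rule complex_vector.subspace_add)
    with that show ?thesis
      unfolding Re_eq by (simp add: norm flip: add)
  qed
  have "Re (cinner (A x) (A (scaleC \<i> y))) = Re (cinner x (scaleC \<i> y))"
    using assms by (intro Re complex_vector.subspace_scale)
  then have "Im (cinner (A x) (A y)) = Im (cinner x y)"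
    unfolding Im_eq by (simp add: scale)
  with Re assms show ?thesis
    by (simp add: complex_eq_iff)
qed

text \<open>The intersection \<open>N\<close> consists of initial vectors, satisfies
  \<open>V N = N\<close>, and has an invariant orthogonal complement. So \<open>V\<close> restricts
  to a unitary on the reducing subspace \<open>N\<close>, which complete non-unitarity excludes
  unless \<open>N\<close> is zero.\<close>

lemma Inter_Ran_tilde_eq_0:
  fixes V :: "'a::{complex_inner,complete_space} \<Rightarrow> 'a"
  assumes V: "partial_isometry V" and cnu: "completely_non_unitary V"
  shows "(\<Inter>l\<in>off_circle. Ran_tilde V l) = {0}"
proof -
  let ?M = "orth_complement (ker V)"
  define N where "N = (\<Inter>l\<in>off_circle. Ran_tilde V l)"
  note lin = bounded_clinear_add [OF partial_isometry_clinear [OF V]]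
    bounded_clinear_scaleC [OF partial_isometry_clinear [OF V]]
    bounded_clinear_diff [OF partial_isometry_clinear [OF V]]
  note subR = subspace_Ran_tilde [OF partial_isometry_clinear [OF V]]
  note subM = subspace_orth_complement [of "ker V"]
  have NI: "f \<in> N" if "\<And>l. l \<in> off_circle \<Longrightarrow> f \<in> Ran_tilde V l" for f
    using that by (auto simp: N_def)
  have ND: "f \<in> Ran_tilde V l" if "f \<in> N" "l \<in> off_circle" for f l
    using that by (auto simp: N_def)
  have zero: "0 \<in> off_circle"
    by simp
  have N_closed: "closed_csubspace N"
    using closed_Ran_tilde [OF V] unfolding N_def closed_csubspace_def
    by (auto intro!: closed_INT complex_vector.subspace_Inter)
  \<comment> \<open>The criterion is used with \<open>g = 0\<close>: each range is a subspace, so it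
    contains \<open>- l f\<close> along with \<open>f\<close>.\<close>
  have N_M: "f \<in> ?M" if "f \<in> N" for f
  proof (rule mem_initial_space [OF V])
    fix l :: complex
    assume "l \<in> off_circle"
    then show "0 - scaleC l f \<in> Ran_tilde V l"
      using that by (intro complex_vector.subspace_diff complex_vector.subspace_scale subR
          complex_vector.subspace_0 ND)
  qed
  have V_N: "V f \<in> N" if f: "f \<in> N" for f
  proof (rule NI)
    fix l :: complex
    assume "l \<in> off_circle"
    then obtain m where m: "m \<in> ?M" "f = V m - scaleC l m"
      using ND [OF f] by (meson Ran_tildeE)
    \<comment> \<open>From \<open>f = (V - l) m\<close> follows \<open>V f = (V - l) (V m)\<close>,
      and \<open>V m = f + l m\<close> is an initial vector because \<open>f\<close> and
      \<open>m\<close> are.\<close>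
    show "V f \<in> Ran_tilde V l"
    proof (rule Ran_tildeI)
      show "f + scaleC l m \<in> ?M"
        by (intro complex_vector.subspace_add complex_vector.subspace_scale subM N_M f m)
      have "f + scaleC l m = V m"
        using m by simp
      then have "V (f + scaleC l m) - scaleC l (f + scaleC l m) = V (V m) - scaleC l (V m)"
        by simp
      also have "\<dots> = V f"
        by (simp add: m(2) lin)
      finally show "V f = V (f + scaleC l m) - scaleC l (f + scaleC l m)" ..
    qed
  qed
  have N_V: "\<exists>m\<in>N. f = V m" if f: "f \<in> N" for f
  proof -
    obtain m where m: "m \<in> ?M" "f = V m"
      using ND [OF f zero] by (auto elim!: Ran_tildeE)
    have "m \<in> N"
    proof (rule NI)
      fix l :: complex
      assume l: "l \<in> off_circle"
      show "m \<in> Ran_tilde V l"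
      proof (cases "l = 0")
        case True
        then show ?thesis
          using mem_Ran_tilde_zero [OF V m(1)] ND [OF f] m(2) by auto
      next
        case False
        obtain k where k: "k \<in> ?M" "f = V k - scaleC l k"
          using ND [OF f l] by (rule Ran_tildeE)
        \<comment> \<open>Here \<open>V m = f = V k - l k\<close>, so
          \<open>V (k - m) = l k\<close>; hence \<open>V - l\<close> sends
          \<open>(k - m) / l\<close> to \<open>k - (k - m) = m\<close>.\<close>
        show ?thesis
        proof (rule Ran_tildeI)
          show "scaleC (inverse l) (k - m) \<in> ?M"
            by (intro complex_vector.subspace_diff complex_vector.subspace_scale subM k m)
          have "V (k - m) = scaleC l k"
            using k(2) m(2) by (simp add: lin)
          then have "V (scaleC (inverse l) (k - m)) = k"
            using False by (simp add: lin(2) scaleC_scaleC scaleC_one)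
          then show "m = V (scaleC (inverse l) (k - m)) - scaleC l (scaleC (inverse l) (k - m))"
            using False by (simp add: scaleC_scaleC scaleC_one)
        qed
      qed
    qed
    with m show ?thesis
      by blast
  qed
  have isom: "cinner (V x) (V y) = cinner x y" if "x \<in> ?M" "y \<in> ?M" for x y
    using lin(1,2) subM partial_isometry_norm [OF V] that
    by (rule cinner_preserving_if_norm_preserving)
  \<comment> \<open>Every \<open>y\<close> in \<open>N\<close> is \<open>V m\<close> with
    \<open>m\<close> in \<open>N\<close>. After removing the kernel part \<open>k\<close> of
    \<open>x\<close>, the isometry turns the inner product into that of \<open>x - k\<close> with
    \<open>m\<close>, and \<open>m\<close> is orthogonal to both \<open>x\<close> and
    \<open>k\<close>.\<close>
  have "V x \<in> orth_complement N" if x: "x \<in> orth_complement N" for x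
  proof -
    obtain k where k: "k \<in> ker V" "x - k \<in> ?M"
      using closed_csubspace_ker [OF partial_isometry_clinear [OF V]]
      by (rule orthogonal_projection_exists)
    have "cinner (V x) y = 0" if y: "y \<in> N" for y
    proof -
      obtain m where m: "m \<in> N" "y = V m"
        using N_V [OF y] by blast
      have "V x = V (x - k)"
        using k(1) by (simp add: lin ker_def)
      then have "cinner (V x) y = cinner (x - k) m"
        using isom k(2) N_M m by simp
      also have "\<dots> = 0"
        using orth_complementD(1) [OF x m(1)] orth_complementD(2) [OF N_M [OF m(1)] k(1)]
        by (simp add: cinner_diff_left)
      finally show ?thesis .
    qed
    then show ?thesis
      by (auto simp: orth_complement_def)
  qed
  then have "reduces N V"
    using N_closed V_N by (auto simp: reduces_def)
  moreover have "unitary_on N V"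
    using V_N N_V isom N_M by (auto simp: unitary_on_def)
  ultimately show ?thesis
    using cnu by (auto simp: completely_non_unitary_def N_def)
qed

text \<open>Once \<open>h\<close> is an initial vector, subtracting \<open>V h - l h\<close> leaves
  \<open>g - V h\<close>, which no longer depends on \<open>l\<close> and so lies in the zero
  intersection.\<close>

lemma eq_apply_if_diff_mem_Ran_tilde:
  fixes V :: "'a::{complex_inner,complete_space} \<Rightarrow> 'a"
  assumes V: "partial_isometry V" and cnu: "completely_non_unitary V"
    and gh: "\<And>l. l \<in> off_circle \<Longrightarrow> g - scaleC l h \<in> Ran_tilde V l"
  shows "h \<in> orth_complement (ker V)" "g = V h"
proof -
  show h: "h \<in> orth_complement (ker V)"
    using V gh by (rule mem_initial_space)
  have "g - V h \<in> Ran_tilde V l" if "l \<in> off_circle" for l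
  proof -
    have "(g - scaleC l h) - (V h - scaleC l h) \<in> Ran_tilde V l"
      using subspace_Ran_tilde [OF partial_isometry_clinear [OF V]] gh [OF that]
        Ran_tildeI [OF h refl] by (rule complex_vector.subspace_diff)
    then show ?thesis
      by simp
  qed
  then have "g - V h \<in> (\<Inter>l\<in>off_circle. Ran_tilde V l)"
    by blast
  then show "g = V h"
    by (simp add: Inter_Ran_tilde_eq_0 [OF V cnu])
qed

text \<open>An intertwining \<open>U\<close> matches kernels, hence initial spaces, hence ranges.
  Conversely, \<open>U (V1 m) - l U m\<close> lies in every range of \<open>V2\<close>, which forces
  \<open>U (V1 m) = V2 (U m)\<close> for initial \<open>m\<close>. The kernels are treated
  separately and match because the initial spaces do.\<close>

lemma unitary_intertwines_iff:
  fixes V1 :: "'a::{complex_inner,complete_space} \<Rightarrow> 'a"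
    and V2 :: "'b::{complex_inner,complete_space} \<Rightarrow> 'b"
  assumes V1: "partial_isometry V1" "completely_non_unitary V1"
    and V2: "partial_isometry V2" "completely_non_unitary V2"
    and U: "unitary_operator U"
  shows "(\<forall>x. U (V1 x) = V2 (U x)) \<longleftrightarrow>
    (\<forall>l\<in>off_circle. \<forall>f. f \<in> Ran_tilde V1 l \<longleftrightarrow> U f \<in> Ran_tilde V2 l)"
    (is "?L \<longleftrightarrow> ?R")
proof -
  let ?M1 = "orth_complement (ker V1)" and ?M2 = "orth_complement (ker V2)"
  have "bounded_clinear U" and surj: "surj U"
    and cinner_U: "\<And>x y. cinner (U x) (U y) = cinner x y"
    using U by (auto simp: unitary_operator_def)
  note lin = bounded_clinear_add [OF \<open>bounded_clinear U\<close>] bounded_clinear_diff [OF \<open>bounded_clinear U\<close>]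
    bounded_clinear_scaleC [OF \<open>bounded_clinear U\<close>] bounded_clinear_zero [OF \<open>bounded_clinear U\<close>]
  have U_eq_0_iff: "U x = 0 \<longleftrightarrow> x = 0" for x
    by (metis cinner_U cinner_eq_zero_iff)
  then have U_eq_iff: "U x = U y \<longleftrightarrow> x = y" for x y
    by (metis eq_iff_diff_eq_0 lin(2))
  note linV1 = bounded_clinear_add [OF partial_isometry_clinear [OF V1(1)]]
  note linV2 = bounded_clinear_add [OF partial_isometry_clinear [OF V2(1)]]
  show ?thesis
  proof
    assume L: ?L
    have ker_U: "x \<in> ker V1 \<longleftrightarrow> U x \<in> ker V2" for x
      by (simp add: ker_def U_eq_0_iff flip: L [rule_format])
    have M_U: "x \<in> ?M1 \<longleftrightarrow> U x \<in> ?M2" for x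
      unfolding orth_complement_def mem_Collect_eq by (metis cinner_U ker_U surj surjD)
    show ?R
    proof (intro ballI allI)
      fix l f
      have "U f \<in> Ran_tilde V2 l \<longleftrightarrow> (\<exists>y\<in>?M2. U f = V2 y - scaleC l y)"
        by (auto simp: Ran_tilde_def)
      also have "\<dots> \<longleftrightarrow> (\<exists>x\<in>?M1. U f = V2 (U x) - scaleC l (U x))"
        by (metis M_U surj surjD)
      also have "\<dots> \<longleftrightarrow> (\<exists>x\<in>?M1. U f = U (V1 x - scaleC l x))"
        using L by (simp add: lin)
      also have "\<dots> \<longleftrightarrow> f \<in> Ran_tilde V1 l"
        by (auto simp: Ran_tilde_def U_eq_iff)
      finally show "f \<in> Ran_tilde V1 l \<longleftrightarrow> U f \<in> Ran_tilde V2 l"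
        by simp
    qed
  next
    assume R: ?R
    have M1: "U m \<in> ?M2" "U (V1 m) = V2 (U m)" if m: "m \<in> ?M1" for m
    proof -
      have mem: "U (V1 m) - scaleC l (U m) \<in> Ran_tilde V2 l" if "l \<in> off_circle" for l
      proof -
        have "U (V1 m - scaleC l m) \<in> Ran_tilde V2 l"
          using R that Ran_tildeI [OF m refl] by blast
        then show ?thesis
          by (simp add: lin)
      qed
      from V2 mem show "U m \<in> ?M2"
        by (rule eq_apply_if_diff_mem_Ran_tilde)
      from V2 mem show "U (V1 m) = V2 (U m)"
        by (rule eq_apply_if_diff_mem_Ran_tilde)
    qed
    \<comment> \<open>The same criterion for \<open>V1\<close>, applied to the preimage
      \<open>g\<close> of \<open>V2 (U h)\<close>, gives the reverse inclusion of initial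
      spaces.\<close>
    have M2: "h \<in> ?M1" if h: "U h \<in> ?M2" for h
    proof -
      obtain g where g: "U g = V2 (U h)"
        by (metis surj surjD)
      have "g - scaleC l h \<in> Ran_tilde V1 l" if "l \<in> off_circle" for l
      proof -
        have "U (g - scaleC l h) \<in> Ran_tilde V2 l"
          using h by (rule Ran_tildeI) (simp add: lin g)
        with R that show ?thesis
          by blast
      qed
      with V1 show ?thesis
        by (rule eq_apply_if_diff_mem_Ran_tilde)
    qed
    have ker: "U k \<in> ker V2" if k: "k \<in> ker V1" for k
    proof -
      have "cinner (U k) y = 0" if y: "y \<in> ?M2" for y
      proof -
        obtain m where m: "y = U m"
          by (metis surj surjD)
        have "cinner k m = 0"
          using M2 y k orth_complementD(2) unfolding m by blast
        then show ?thesis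
          by (simp add: cinner_U m)
      qed
      then have "U k \<in> orth_complement ?M2"
        by (auto simp: orth_complement_def [of ?M2])
      then show ?thesis
        by (simp add: orth_complement_orth_complement closed_csubspace_ker
            partial_isometry_clinear V2)
    qed
    show ?L
    proof
      fix x
      obtain k where k: "k \<in> ker V1" "x - k \<in> ?M1"
        using closed_csubspace_ker [OF partial_isometry_clinear [OF V1(1)]]
        by (rule orthogonal_projection_exists)
      have "U (V1 (x - k)) = V2 (U (x - k))"
        using k(2) by (rule M1)
      moreover have "V1 k = 0" "V2 (U k) = 0"
        using k(1) ker by (simp_all add: ker_def)
      ultimately show "U (V1 x) = V2 (U x)"
        using linV1 [of "x - k" k] linV2 [of "U (x - k)" "U k"] lin(1) [of "x - k" k] by simp
    qed
  qed
qed

section \<open>The model transform\<close>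

lemma is_modelD:
  assumes "is_model V \<Gamma>" "l \<in> off_circle"
  shows "bounded_clinear (\<Gamma> l)" "inj (\<Gamma> l)" "range (\<Gamma> l) = orth_complement (Ran_tilde V l)"
  using assms by (auto simp: is_model_def bij_betw_def)

text \<open>The kernel of the adjoint is the complement of the range of \<open>\<Gamma> l\<close>,
  that is, the double complement of \<open>Ran_tilde V l\<close>; closedness off the circle removes
  the double complement.\<close>

lemma cadjoint_eq_0_iff:
  fixes V :: "'a::{complex_inner,complete_space} \<Rightarrow> 'a"
  assumes V: "partial_isometry V" and \<Gamma>: "is_model V \<Gamma>" and l: "l \<in> off_circle"
  shows "cadjoint (\<Gamma> l) f = 0 \<longleftrightarrow> f \<in> Ran_tilde V l"
proof -
  note adj = cadjoint_works [OF is_modelD(1) [OF \<Gamma> l]]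
  have "cadjoint (\<Gamma> l) f = 0 \<longleftrightarrow> (\<forall>x. cinner (\<Gamma> l x) f = 0)"
    unfolding adj using cinner_eq_zero_iff [of "cadjoint (\<Gamma> l) f"] by auto
  also have "\<dots> \<longleftrightarrow> (\<forall>y\<in>range (\<Gamma> l). cinner f y = 0)"
    by (subst cinner_commute) simp
  also have "\<dots> \<longleftrightarrow> f \<in> orth_complement (orth_complement (Ran_tilde V l))"
    unfolding is_modelD(3) [OF \<Gamma> l] by (subst (2) orth_complement_def) simp
  finally show ?thesis
    by (simp add: orth_complement_orth_complement closed_Ran_tilde [OF V l])
qed

lemma scaleC_vec_eq: "scaleC c x = c *s x" for x :: "complex ^ 'n"
  by (simp add: vec_eq_iff scaleC_vec_def scaleC_complex_def)

lemma linear_cadjoint: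
  fixes A :: "complex ^ 'n \<Rightarrow> 'b::complex_inner"
  assumes "bounded_clinear A"
  shows "Vector_Spaces.linear scaleC (*s) (cadjoint A)"
proof (unfold_locales)
  note adj = cadjoint_works [OF assms, symmetric]
  have adj': "cinner (cadjoint A y) x = cinner y (A x)" for x y
    by (metis adj cinner_commute)
  show "cadjoint A (x + y) = cadjoint A x + cadjoint A y" for x y
    by (rule cinner_ext) (simp add: adj' cinner_add_left)
  show "cadjoint A (scaleC c x) = c *s cadjoint A x" for c x
    unfolding scaleC_vec_eq [symmetric]
    by (rule cinner_ext) (simp add: adj' cinner_scaleC_left)
qed

text \<open>The adjoint composed with \<open>A\<close> is a square matrix \<open>K\<close>,
  injective because the inner product of \<open>x\<close> with \<open>K x\<close> is
  \<open>(norm (A x))\<^sup>2\<close>. Hence \<open>K\<close> is onto, and the adjoint is onto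
  already on the range of \<open>A\<close>.\<close>

lemma surj_cadjoint:
  fixes A :: "complex ^ 'n \<Rightarrow> 'b::complex_inner"
  assumes A: "bounded_clinear A" and "inj A"
  shows "surj (cadjoint A)"
proof -
  interpret adj: Vector_Spaces.linear scaleC "(*s)" "cadjoint A"
    using A by (rule linear_cadjoint)
  have lin: "Vector_Spaces.linear (*s) (*s) (\<lambda>x. cadjoint A (A x))"
    by unfold_locales
      (simp_all add: bounded_clinear_add [OF A] adj.add adj.scale bounded_clinear_scaleC [OF A]
        flip: scaleC_vec_eq)
  define K where "K = matrix (\<lambda>x. cadjoint A (A x))"
  have K: "K *v x = cadjoint A (A x)" for x
    unfolding K_def using lin by (rule matrix_works)
  have "x = 0" if "K *v x = 0" for x
  proof -
    have "cinner (A x) (A x) = 0"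
      using that by (simp add: cadjoint_works [OF A] K)
    then have "A x = A 0"
      by (simp add: cinner_eq_zero_iff bounded_clinear_zero [OF A])
    with \<open>inj A\<close> show ?thesis
      by (simp add: inj_eq)
  qed
  then have "\<exists>B. B ** K = mat 1"
    by (simp add: matrix_left_invertible_ker)
  then have "surj ((*v) K)"
    by (simp add: matrix_left_right_inverse flip: matrix_right_invertible_surjective)
  then show ?thesis
    by (metis K surj_def)
qed

lemma model_transform_inj:
  fixes V :: "'a::{complex_inner,complete_space} \<Rightarrow> 'a"
  assumes V: "partial_isometry V" and cnu: "completely_non_unitary V" and \<Gamma>: "is_model V \<Gamma>"
  shows "inj (model_transform \<Gamma>)"
proof (rule injI)
  fix f g
  assume eq: "model_transform \<Gamma> f = model_transform \<Gamma> g"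
  have "f - g \<in> Ran_tilde V l" if l: "l \<in> off_circle" for l
  proof -
    interpret adj: Vector_Spaces.linear scaleC "(*s)" "cadjoint (\<Gamma> l)"
      using is_modelD(1) [OF \<Gamma> l] by (rule linear_cadjoint)
    have "cadjoint (\<Gamma> l) f = cadjoint (\<Gamma> l) g"
      using fun_cong [OF eq, of l] l by (simp add: model_transform_def)
    then have "cadjoint (\<Gamma> l) (f - g) = 0"
      by (simp add: adj.diff)
    then show ?thesis
      using cadjoint_eq_0_iff [OF V \<Gamma> l] by blast
  qed
  then have "f - g \<in> (\<Inter>l\<in>off_circle. Ran_tilde V l)"
    by blast
  then show "f = g"
    by (simp add: Inter_Ran_tilde_eq_0 [OF V cnu])
qed

lemma model_norm_transform:
  assumes "inj (model_transform \<Gamma>)"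
  shows "model_norm \<Gamma> (model_transform \<Gamma> f) = norm f"
  by (simp add: model_norm_def model_cinner_transform [OF assms] norm_eq_sqrt_cinner)

section \<open>Analytic dependence on the parameter and matrix factorization\<close>

lemma cadjoint_nth:
  fixes A :: "complex ^ 'n \<Rightarrow> 'b::complex_inner"
  assumes "bounded_clinear A"
  shows "cadjoint A f $ i = cnj (cinner (A (axis i 1)) f)"
  unfolding cadjoint_works [OF assms]
  by (simp add: cinner_vec_def cinner_complex_def axis_def if_distrib if_distribR cong: if_cong)

text \<open>The coordinate is the conjugate of the inner product of \<open>\<Gamma> l\<close> at a
  basis vector with \<open>f\<close>. That inner product is holomorphic in the conjugate of
  \<open>l\<close>, so conjugating both argument and value gives a holomorphic function.\<close>

lemma holomorphic_cadjoint:
  fixes \<Gamma> :: "complex \<Rightarrow> complex ^ 'n \<Rightarrow> 'a::complex_inner"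
  assumes anti: "operator_antianalytic_on \<Gamma> S" and S: "open S"
    and \<Gamma>: "\<And>l. l \<in> S \<Longrightarrow> bounded_clinear (\<Gamma> l)"
  shows "(\<lambda>l. cadjoint (\<Gamma> l) f $ i) holomorphic_on S"
proof -
  let ?e = "axis i 1 :: complex ^ 'n" and ?F = "\<lambda>z. \<Gamma> (cnj z)"
  let ?h = "\<lambda>z. cinner (?F z ?e) f"
  have "cnj ` S = cnj -` S"
    by (auto simp: image_iff) (metis complex_cnj_cnj)
  moreover have "open (cnj -` S)"
    using S by (intro open_vimage continuous_on_cnj continuous_on_id)
  ultimately have "open (cnj ` S)"
    by simp
  have "?h field_differentiable (at z within cnj ` S)" if z: "z \<in> cnj ` S" for z
  proof -
    let ?Q = "\<lambda>D w x. scaleC (inverse (w - z)) (?F w x - ?F z x) - D x"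
    obtain D where D: "bounded_clinear D" and lim: "((\<lambda>w. onorm (?Q D w)) \<longlongrightarrow> 0) (at z)"
      using anti z unfolding operator_antianalytic_on_def operator_analytic_on_def by meson
    have F: "bounded_linear (?F w)" if "w \<in> cnj ` S" for w
      using that \<Gamma> by (auto simp: bounded_clinear_bounded_linear)
    have bound: "norm ((?h w - ?h z) / (w - z) - cinner (D ?e) f)
        \<le> onorm (?Q D w) * norm ?e * norm f" if w: "w \<in> cnj ` S" for w
    proof -
      have "(?h w - ?h z) / (w - z) - cinner (D ?e) f = cinner (?Q D w ?e) f"
        by (simp add: cinner_diff_left cinner_scaleC_left divide_inverse mult.commute)
      \<comment> \<open>Only for a bounded linear map does \<open>onorm\<close> bound the values;
        this is why \<open>w\<close> is kept in the open set where \<open>\<Gamma>\<close> is known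
        to be bounded.\<close>
      moreover have "bounded_linear (?Q D w)"
        using bounded_linear_compose [OF bounded_linear_scaleC
            bounded_linear_sub [OF F [OF w] F [OF z]]] bounded_clinear_bounded_linear [OF D]
        by (rule bounded_linear_sub)
      then have "norm (?Q D w ?e) * norm f \<le> onorm (?Q D w) * norm ?e * norm f"
        by (intro mult_right_mono onorm) auto
      ultimately show ?thesis
        using cinner_Cauchy_Schwarz [of "?Q D w ?e" f] by simp
    qed
    have "((\<lambda>w. (?h w - ?h z) / (w - z) - cinner (D ?e) f) \<longlongrightarrow> 0) (at z)"
    proof (rule Lim_null_comparison)
      show "\<forall>\<^sub>F w in at z. norm ((?h w - ?h z) / (w - z) - cinner (D ?e) f)
          \<le> onorm (?Q D w) * norm ?e * norm f"
        using eventually_at_in_open' [OF \<open>open (cnj ` S)\<close> z] by eventually_elim (rule bound)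
      show "((\<lambda>w. onorm (?Q D w) * norm ?e * norm f) \<longlongrightarrow> 0) (at z)"
        using tendsto_mult_left_zero [OF tendsto_mult_left_zero [OF lim]] .
    qed
    then have "(?h has_field_derivative cinner (D ?e) f) (at z)"
      by (simp add: has_field_derivative_iff LIM_zero_iff)
    then show ?thesis
      using field_differentiable_at_within field_differentiable_def by blast
  qed
  then have "?h holomorphic_on cnj ` S"
    by (simp add: holomorphic_on_def)
  then have "cnj \<circ> ?h \<circ> cnj holomorphic_on S"
    using S by (rule holomorphic_on_compose_cnj_cnj)
  then show ?thesis
    by (rule holomorphic_transform) (simp add: cadjoint_nth \<Gamma>)
qed

lemma holomorphic_on_det:
  assumes "\<And>i j. (\<lambda>z. A z $ i $ j) holomorphic_on S"
  shows "(\<lambda>z. det (A z)) holomorphic_on S"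
  unfolding det_def using assms by (intro holomorphic_intros)

text \<open>The columns of \<open>P\<close> are the values of \<open>B\<close> at preimages
  \<open>s j\<close> of the basis vectors. Any \<open>f\<close> differs from the combination of the
  \<open>s j\<close> with coefficients \<open>A f\<close> by a vector of the kernel of
  \<open>A\<close>, on which \<open>B\<close> vanishes.\<close>

lemma linear_factorization:
  fixes A :: "'a::complex_vector \<Rightarrow> complex ^ 'n" and B :: "'a \<Rightarrow> complex ^ 'm"
  assumes A: "Vector_Spaces.linear scaleC (*s) A" and B: "Vector_Spaces.linear scaleC (*s) B"
    and "surj A" and ker: "\<And>f. A f = 0 \<Longrightarrow> B f = 0"
  shows "\<exists>P. \<forall>f. B f = P *v A f"
proof -
  interpret A: Vector_Spaces.linear scaleC "(*s)" A by (rule A)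
  interpret B: Vector_Spaces.linear scaleC "(*s)" B by (rule B)
  define s where "s = (\<lambda>j. inv A (axis j 1))"
  have s: "A (s j) = axis j 1" for j
    using \<open>surj A\<close> by (simp add: s_def surj_f_inv_f)
  define P where "P = (\<chi> i j. B (s j) $ i)"
  have "B f = P *v A f" for f
  proof -
    let ?g = "\<Sum>j\<in>UNIV. scaleC (A f $ j) (s j)"
    have "A ?g = (\<Sum>j\<in>UNIV. (A f $ j) *s axis j 1)"
      by (simp add: A.sum A.scale s)
    also have "\<dots> = A f"
      by (rule basis_expansion)
    finally have "B (f - ?g) = 0"
      by (intro ker) (simp add: A.diff)
    then have "B f = (\<Sum>j\<in>UNIV. (A f $ j) *s B (s j))"
      by (simp add: B.diff B.sum B.scale)
    also have "\<dots> = P *v A f"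
      by (simp add: P_def vec_eq_iff matrix_vector_mult_def mult.commute)
    finally show ?thesis .
  qed
  then show ?thesis
    by blast
qed

text \<open>Vectors \<open>a z (s j)\<close> that form the standard basis at \<open>z = z\<^sub>0\<close> stay linearly independent
  nearby, so Cramer's rule expresses the entries of \<open>\<Phi>\<close> as quotients of determinants.\<close>

lemma analytic_on_factor:
  fixes a :: "complex \<Rightarrow> 'i \<Rightarrow> complex ^ 'n" and b :: "complex \<Rightarrow> 'i \<Rightarrow> complex ^ 'm"
  assumes S: "open S"
    and a: "\<And>f j. (\<lambda>z. a z f $ j) holomorphic_on S"
    and b: "\<And>f j. (\<lambda>z. b z f $ j) holomorphic_on S"
    and surj: "\<And>z. z \<in> S \<Longrightarrow> surj (a z)"
    and \<Phi>: "\<And>z f. z \<in> S \<Longrightarrow> b z f = \<Phi> z *v a z f"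
  shows "(\<lambda>z. \<Phi> z $ i $ j) analytic_on S"
proof (subst analytic_on_analytic_at, intro ballI)
  fix z0
  assume z0: "z0 \<in> S"
  define s where "s = (\<lambda>k. inv (a z0) (axis k 1))"
  have s: "a z0 (s k) = axis k 1" for k
    using surj [OF z0] by (simp add: s_def surj_f_inv_f)
  \<comment> \<open>The rows of \<open>G z\<close> are the vectors \<open>a z (s k)\<close>, so row
    \<open>i\<close> of \<open>\<Phi> z\<close> solves the linear system with matrix
    \<open>G z\<close> and right-hand side \<open>v z\<close>.\<close>
  define G where "G = (\<lambda>z. \<chi> k l. a z (s k) $ l)"
  define v where "v = (\<lambda>z. (\<chi> k. b z (s k) $ i) :: complex ^ 'n)"
  have det_hol: "(\<lambda>z. det (G z)) holomorphic_on S"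
    by (rule holomorphic_on_det) (simp add: G_def a)
  define T where "T = {z \<in> S. det (G z) \<noteq> 0}"
  have "open T"
  proof -
    have "open (S \<inter> (\<lambda>z. det (G z)) -` (- {0}))"
      using S det_hol by (intro continuous_open_preimage holomorphic_on_imp_continuous_on) auto
    moreover have "S \<inter> (\<lambda>z. det (G z)) -` (- {0}) = T"
      by (auto simp: T_def)
    ultimately show ?thesis
      by simp
  qed
  have "G z0 = mat 1"
    by (simp add: G_def s axis_def mat_def vec_eq_iff)
  then have "z0 \<in> T"
    using z0 by (simp add: T_def)
  \<comment> \<open>The numerator matrix in Cramer's rule: \<open>G z\<close> with column
    \<open>j\<close> replaced by \<open>v z\<close>.\<close>
  let ?C = "\<lambda>z. \<chi> k l. if l = j then v z $ k else G z $ k $ l"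
  have "T \<subseteq> S"
    by (auto simp: T_def)
  have "(\<lambda>z. det (?C z) / det (G z)) holomorphic_on T"
  proof (intro holomorphic_on_divide holomorphic_on_subset [OF _ \<open>T \<subseteq> S\<close>] det_hol)
    show "(\<lambda>z. det (?C z)) holomorphic_on S"
    proof (rule holomorphic_on_det)
      show "(\<lambda>z. ?C z $ k $ l) holomorphic_on S" for k l
        by (cases "l = j") (simp_all add: v_def G_def a b)
    qed
  qed (simp add: T_def)
  then have "(\<lambda>z. \<Phi> z $ i $ j) holomorphic_on T"
  proof (rule holomorphic_transform)
    fix z
    assume z: "z \<in> T"
    have "G z *v (\<Phi> z $ i) = v z"
      using z by (simp add: G_def v_def T_def \<Phi> vec_eq_iff matrix_vector_mult_def mult.commute)
    then have "\<Phi> z $ i = (\<chi> k. det (\<chi> p q. if q = k then v z $ p else G z $ p $ q) / det (G z))"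
      using z by (subst (asm) cramer) (simp_all add: T_def)
    then show "det (?C z) / det (G z) = \<Phi> z $ i $ j"
      by simp
  qed
  with \<open>open T\<close> \<open>z0 \<in> T\<close> show "(\<lambda>z. \<Phi> z $ i $ j) analytic_on {z0}"
    by (auto simp: analytic_at)
qed

section \<open>The two directions of the equivalence\<close>

text \<open>Since \<open>U\<close> matches the ranges, \<open>cadjoint (\<Gamma>2 l) (U f)\<close>
  vanishes whenever \<open>cadjoint (\<Gamma>1 l) f\<close> does, so it factors through it by a
  matrix \<open>\<Phi> l\<close>. The matrices are chosen pointwise; Cramer's rule makes them
  analytic.\<close>

lemma ex_multiplier_if_unitarily_equivalent:
  fixes V1 :: "'a::{complex_inner,complete_space} \<Rightarrow> 'a"
    and V2 :: "'b::{complex_inner,complete_space} \<Rightarrow> 'b"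
    and \<Gamma>1 :: "complex \<Rightarrow> complex ^ 'n \<Rightarrow> 'a" and \<Gamma>2 :: "complex \<Rightarrow> complex ^ 'n \<Rightarrow> 'b"
  assumes V1: "partial_isometry V1" "completely_non_unitary V1"
    and V2: "partial_isometry V2" "completely_non_unitary V2"
    and \<Gamma>1: "is_model V1 \<Gamma>1" and \<Gamma>2: "is_model V2 \<Gamma>2"
    and "unitarily_equivalent V1 V2"
  shows "\<exists>\<Phi>. isometric_multiplier \<Phi> \<Gamma>1 \<Gamma>2"
proof -
  obtain U where U: "unitary_operator U" and "\<forall>x. U (V1 x) = V2 (U x)"
    using assms by (auto simp: unitarily_equivalent_def)
  then have Ran: "f \<in> Ran_tilde V1 l \<longleftrightarrow> U f \<in> Ran_tilde V2 l" if "l \<in> off_circle" for l f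
    using unitary_intertwines_iff [OF V1 V2 U] that by blast
  have cU: "bounded_clinear U" and surjU: "surj U"
    using U by (auto simp: unitary_operator_def)
  have normU: "norm (U f) = norm f" for f
    using U by (simp add: norm_eq_sqrt_cinner unitary_operator_def)
  have surj: "surj (cadjoint (\<Gamma>1 l))" if "l \<in> off_circle" for l
    using is_modelD [OF \<Gamma>1 that] by (intro surj_cadjoint)
  have "\<exists>P. \<forall>f. cadjoint (\<Gamma>2 l) (U f) = P *v cadjoint (\<Gamma>1 l) f" if l: "l \<in> off_circle" for l
  proof (rule linear_factorization)
    interpret adj: Vector_Spaces.linear scaleC "(*s)" "cadjoint (\<Gamma>2 l)"
      using is_modelD(1) [OF \<Gamma>2 l] by (rule linear_cadjoint)
    show "Vector_Spaces.linear scaleC (*s) (cadjoint (\<Gamma>1 l))"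
      using is_modelD(1) [OF \<Gamma>1 l] by (rule linear_cadjoint)
    show "Vector_Spaces.linear scaleC (*s) (\<lambda>f. cadjoint (\<Gamma>2 l) (U f))"
      by unfold_locales
        (simp_all add: bounded_clinear_add [OF cU] bounded_clinear_scaleC [OF cU] adj.add adj.scale)
    show "surj (cadjoint (\<Gamma>1 l))"
      using l by (rule surj)
    show "cadjoint (\<Gamma>2 l) (U f) = 0" if "cadjoint (\<Gamma>1 l) f = 0" for f
      using that l Ran cadjoint_eq_0_iff [OF V1(1) \<Gamma>1 l] cadjoint_eq_0_iff [OF V2(1) \<Gamma>2 l]
      by blast
  qed
  then obtain \<Phi> where \<Phi>:
    "\<And>l f. l \<in> off_circle \<Longrightarrow> cadjoint (\<Gamma>2 l) (U f) = \<Phi> l *v cadjoint (\<Gamma>1 l) f"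
    by metis
  \<comment> \<open>On the circle both sides take the default value of restricted functions.\<close>
  then have mult: "mult_op \<Phi> (model_transform \<Gamma>1 f) = model_transform \<Gamma>2 (U f)" for f
    by (auto simp: mult_op_def model_transform_def fun_eq_iff)
  have open_off: "open off_circle"
    by (intro open_Compl closed_sphere)
  have "isometric_multiplier \<Phi> \<Gamma>1 \<Gamma>2"
    unfolding isometric_multiplier_def
  proof (intro conjI allI ballI)
    fix i j
    show "(\<lambda>l. \<Phi> l $ i $ j) analytic_on off_circle"
    proof (rule analytic_on_factor [OF open_off _ _ surj \<Phi>])
      show "(\<lambda>z. cadjoint (\<Gamma>1 z) f $ j) holomorphic_on off_circle" for f j
        using \<Gamma>1 open_off by (intro holomorphic_cadjoint) (auto simp: is_model_def)
      show "(\<lambda>z. cadjoint (\<Gamma>2 z) (U f) $ j) holomorphic_on off_circle" for f j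
        using \<Gamma>2 open_off by (intro holomorphic_cadjoint) (auto simp: is_model_def)
    qed
  next
    show "mult_op \<Phi> ` model_space \<Gamma>1 = model_space \<Gamma>2"
      unfolding model_space_def image_image mult
      by (metis image_image surjU)
  next
    fix F
    assume "F \<in> model_space \<Gamma>1"
    then obtain f where "F = model_transform \<Gamma>1 f"
      by (auto simp: model_space_def)
    then show "model_norm \<Gamma>2 (mult_op \<Phi> F) = model_norm \<Gamma>1 F"
      by (simp add: mult normU model_norm_transform model_transform_inj [OF V1 \<Gamma>1]
          model_transform_inj [OF V2 \<Gamma>2])
  qed
  then show ?thesis
    by blast
qed

text \<open>Pulling multiplication by \<open>\<Phi>\<close> back through the injective transforms
  gives a surjective linear isometry \<open>U\<close>. Each \<open>\<Phi> l\<close> is invertible,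
  so \<open>U\<close> matches the ranges in both directions and therefore intertwines.\<close>

lemma unitarily_equivalent_if_multiplier:
  fixes V1 :: "'a::{complex_inner,complete_space} \<Rightarrow> 'a"
    and V2 :: "'b::{complex_inner,complete_space} \<Rightarrow> 'b"
    and \<Gamma>1 :: "complex \<Rightarrow> complex ^ 'n \<Rightarrow> 'a" and \<Gamma>2 :: "complex \<Rightarrow> complex ^ 'n \<Rightarrow> 'b"
  assumes V1: "partial_isometry V1" "completely_non_unitary V1"
    and V2: "partial_isometry V2" "completely_non_unitary V2"
    and \<Gamma>1: "is_model V1 \<Gamma>1" and \<Gamma>2: "is_model V2 \<Gamma>2"
    and \<Phi>: "isometric_multiplier \<Phi> \<Gamma>1 \<Gamma>2"
  shows "unitarily_equivalent V1 V2"
proof -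
  let ?T1 = "model_transform \<Gamma>1" and ?T2 = "model_transform \<Gamma>2"
  have inj1: "inj ?T1" and inj2: "inj ?T2"
    using V1 V2 \<Gamma>1 \<Gamma>2 by (auto intro: model_transform_inj)
  have image: "(\<lambda>f. mult_op \<Phi> (?T1 f)) ` UNIV = range ?T2"
    and isom: "\<And>f. model_norm \<Gamma>2 (mult_op \<Phi> (?T1 f)) = model_norm \<Gamma>1 (?T1 f)"
    using \<Phi> by (auto simp: isometric_multiplier_def model_space_def image_image)
  \<comment> \<open>The multiplier maps into the range of the second transform, so
    \<open>inv\<close> yields a genuine preimage.\<close>
  define U where "U = (\<lambda>f. inv ?T2 (mult_op \<Phi> (?T1 f)))"
  have T2_U: "?T2 (U f) = mult_op \<Phi> (?T1 f)" for f
    unfolding U_def using image by (intro f_inv_into_f) blast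
  have adj_U: "cadjoint (\<Gamma>2 l) (U f) = \<Phi> l *v cadjoint (\<Gamma>1 l) f"
    if "l \<in> off_circle" for l f
    using fun_cong [OF T2_U, of f l] that by (simp add: mult_op_def model_transform_def)
  \<comment> \<open>The adjoints jointly separate vectors, so linearity of \<open>U\<close> can be
    checked at each \<open>l\<close>, where it is linearity of matrix multiplication.\<close>
  have eqI: "f = g" if "\<And>l. l \<in> off_circle \<Longrightarrow> cadjoint (\<Gamma>2 l) f = cadjoint (\<Gamma>2 l) g" for f g
    by (rule injD [OF inj2]) (auto simp: model_transform_def intro!: restrict_ext that)
  note lin1 = linear_cadjoint [OF is_modelD(1) [OF \<Gamma>1]]
  note lin2 = linear_cadjoint [OF is_modelD(1) [OF \<Gamma>2]]
  have U_add: "U (f + g) = U f + U g" for f g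
    by (rule eqI) (simp add: adj_U matrix_vector_right_distrib
        module_hom.add [OF Vector_Spaces.linear.axioms(3) [OF lin1]]
        module_hom.add [OF Vector_Spaces.linear.axioms(3) [OF lin2]])
  have U_scale: "U (scaleC c f) = scaleC c (U f)" for c f
    by (rule eqI) (simp add: adj_U vector_scalar_commute
        module_hom.scale [OF Vector_Spaces.linear.axioms(3) [OF lin1]]
        module_hom.scale [OF Vector_Spaces.linear.axioms(3) [OF lin2]])
  have U_norm: "norm (U f) = norm f" for f
    using isom [of f] by (simp add: model_norm_transform inj1 inj2 flip: T2_U)
  have surjU: "surj U"
    unfolding surj_def
  proof
    fix g
    obtain f where "?T2 g = mult_op \<Phi> (?T1 f)"
      using image by blast
    then have "g = U f"
      unfolding T2_U [symmetric] by (rule injD [OF inj2])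
    then show "\<exists>f. g = U f" ..
  qed
  have "cinner (U f) (U g) = cinner f g" for f g
    by (rule cinner_preserving_if_norm_preserving [where S = UNIV])
      (simp_all add: U_add U_scale U_norm)
  moreover have "bounded_clinear U"
    unfolding bounded_clinear_def
    by (auto intro!: bounded_linear_intro [where K = 1] simp: U_add U_scale scaleR_scaleC U_norm)
  ultimately have U: "unitary_operator U"
    using surjU by (simp add: unitary_operator_def)
  have "f \<in> Ran_tilde V1 l \<longleftrightarrow> U f \<in> Ran_tilde V2 l" if l: "l \<in> off_circle" for l f
  proof -
    \<comment> \<open>With \<open>U\<close> onto as well, every vector has the form
      \<open>\<Phi> l *v x\<close>; a square matrix that is onto is also injective.\<close>
    have "surj (cadjoint (\<Gamma>2 l))"
      using is_modelD [OF \<Gamma>2 l] by (intro surj_cadjoint)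
    then have "surj ((*v) (\<Phi> l))"
      by (metis adj_U [OF l] surj_def surjU)
    then have "\<exists>B. B ** \<Phi> l = mat 1"
      by (simp add: matrix_left_right_inverse flip: matrix_right_invertible_surjective)
    then have "\<Phi> l *v x = 0 \<longleftrightarrow> x = 0" for x
      by (auto simp: matrix_left_invertible_ker)
    then show ?thesis
      using adj_U [OF l, of f] cadjoint_eq_0_iff [OF V1(1) \<Gamma>1 l] cadjoint_eq_0_iff [OF V2(1) \<Gamma>2 l]
      by metis
  qed
  then have "\<forall>x. U (V1 x) = V2 (U x)"
    using unitary_intertwines_iff [OF V1 V2 U] by blast
  with U show ?thesis
    by (auto simp: unitarily_equivalent_def)
qed

theorem mainTheorem3:
  fixes V1 :: "'a::separable_chilbert_space \<Rightarrow> 'a"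
    and V2 :: "'b::separable_chilbert_space \<Rightarrow> 'b"
    and \<Gamma>1 :: "complex \<Rightarrow> complex ^ 'n::finite \<Rightarrow> 'a"
    and \<Gamma>2 :: "complex \<Rightarrow> complex ^ 'n \<Rightarrow> 'b"
  assumes "V1 \<in> cnu_partial_isometries CARD('n)"
    and "V2 \<in> cnu_partial_isometries CARD('n)"
    and "is_model V1 \<Gamma>1"
    and "is_model V2 \<Gamma>2"
  shows "unitarily_equivalent V1 V2 \<longleftrightarrow> (\<exists>\<Phi>. isometric_multiplier \<Phi> \<Gamma>1 \<Gamma>2)"
proof -
  have "partial_isometry V1" "completely_non_unitary V1"
    "partial_isometry V2" "completely_non_unitary V2"
    using assms by (auto simp: cnu_partial_isometries_def)
  with assms show ?thesis
    by (metis ex_multiplier_if_unitarily_equivalent unitarily_equivalent_if_multiplier)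
qed

end
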